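(* Let $R$ be an integral domain with quotient field $K$. The following statements are equivalent. (1) $R$ is a $t\#$-domain. (2) For each $N \in t\text{-Max}(R)$, $\bigcap_{M \in t\text{-Max}(R) \setminus \{N\}} R_M \nsubseteq R_N$. (3) For each $N \in t\text{-Max}(R)$, $R \neq \bigcap_{M \in t\text{-Max}(R) \setminus \{N\}} R_M$. (4) $\bigcap_{M \in \mathcal M_1} R_M$ and $\bigcap_{M \in \mathcal M_2} R_M$ are incomparable under inclusion for each pair of disjoint nonempty subsets $\mathcal M_1, \mathcal M_2$ of $t\text{-Max}(R)$. (5) For each maximal $t$-ideal $M$ of $R$, there is a divisorial ideal of $R$ which is contained in $M$ and in no other maximal $t$-ideal of $R$. (6) For each maximal $t$-ideal $M$ of $R$, there is an element $u \in K \setminus R$ such that $M$ is the only maximal $t$-ideal of $R$ containing $(R:_R u)$.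
   Context: For a nonzero fractional ideal $I$ of $R$: $I^{-1} = \{x \in K \mid xI \subseteq R\}$, $I_v = (I^{-1})^{-1}$, and $I_t = \bigcup J_v$, the union over all nonzero finitely generated $J \subseteq I$. $I$ is divisorial if $I = I_v$, and a $t$-ideal if $I = I_t$. A maximal $t$-ideal is an ideal maximal among the proper nonzero (integral) $t$-ideals of $R$ (such ideals are prime); $t\text{-Max}(R)$ is the set of maximal $t$-ideals. $(R:_R u) = \{r \in R \mid ru \in R\}$. An intersection of localizations over an empty set of primes is $K$. $R$ is a $t\#$-domain (has the $t\#$-property) if $\bigcap_{M \in \mathcal M_1} R_M \neq \bigcap_{M \in \mathcal M_2} R_M$ for any two distinct subsets $\mathcal M_1, \mathcal M_2$ of $t\text{-Max}(R)$. *)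

theory Defs
  imports "HOL-Computational_Algebra.Polynomial_Factorial"
begin

text \<open>
  The integral domain \<open>R\<close> is the type \<open>'a\<close> and its quotient field \<open>K\<close> is the type
  \<open>'a fract\<close>. All (fractional) ideals, overrings and localizations are subsets of
  \<open>'a fract\<close>; \<open>R\<close> itself is identified with its image in \<open>K\<close>.
\<close>

definition base_ring :: "'a::idom fract set" where
  "base_ring = range to_fract"

text \<open>
  \<open>K\<close> as an \<open>R\<close>-module: \<open>frac.subspace\<close> and \<open>frac.span\<close> are the library's notions of
  \<open>R\<close>-submodule of \<open>K\<close> and of \<open>R\<close>-submodule generated by a set.
\<close>

global_interpretation frac: module "\<lambda>(r::'a::idom) x. to_fract r * x"
  by unfold_locales (simp_all add: algebra_simps)

definition nonzero_fractional_ideal :: "'a::idom fract set \<Rightarrow> bool" where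
  "nonzero_fractional_ideal I \<longleftrightarrow>
     frac.subspace I \<and> I \<noteq> {0} \<and> (\<exists>d. d \<noteq> 0 \<and> (\<forall>x\<in>I. to_fract d * x \<in> base_ring))"

definition finitely_generated :: "'a::idom fract set \<Rightarrow> bool" where
  "finitely_generated J \<longleftrightarrow> (\<exists>S. finite S \<and> J = frac.span S)"

definition ideal_inverse :: "'a::idom fract set \<Rightarrow> 'a fract set" where
  "ideal_inverse I = {x. \<forall>y\<in>I. x * y \<in> base_ring}"

definition v_closure :: "'a::idom fract set \<Rightarrow> 'a fract set" where
  "v_closure I = ideal_inverse (ideal_inverse I)"

definition t_closure :: "'a::idom fract set \<Rightarrow> 'a fract set" where
  "t_closure I = \<Union> {v_closure J | J. finitely_generated J \<and> J \<noteq> {0} \<and> J \<subseteq> I}"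

definition divisorial :: "'a::idom fract set \<Rightarrow> bool" where
  "divisorial I \<longleftrightarrow> nonzero_fractional_ideal I \<and> I = v_closure I"

definition t_ideal :: "'a::idom fract set \<Rightarrow> bool" where
  "t_ideal I \<longleftrightarrow> nonzero_fractional_ideal I \<and> I = t_closure I"

definition proper_integral_t_ideal :: "'a::idom fract set \<Rightarrow> bool" where
  "proper_integral_t_ideal I \<longleftrightarrow> t_ideal I \<and> I \<subset> base_ring"

definition t_Max :: "'a::idom fract set set" where
  "t_Max = {M. proper_integral_t_ideal M \<and>
               (\<forall>I. proper_integral_t_ideal I \<and> M \<subseteq> I \<longrightarrow> I = M)}"

definition localization :: "'a::idom fract set \<Rightarrow> 'a fract set" where
  "localization P = {a / s | a s. a \<in> base_ring \<and> s \<in> base_ring - P}"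

definition conductor :: "'a::idom fract \<Rightarrow> 'a fract set" where
  "conductor u = {r \<in> base_ring. r * u \<in> base_ring}"

text \<open>
  The property is one of the domain, i.e. of the type \<open>'a\<close>, whence the \<open>itself\<close> argument.
  An intersection over the empty set of primes is \<open>UNIV\<close>, i.e. \<open>K\<close>.
\<close>

definition t_sharp_domain :: "'a::idom itself \<Rightarrow> bool" where
  "t_sharp_domain _ \<longleftrightarrow>
     (\<forall>\<M>1 \<M>2 :: 'a fract set set. \<M>1 \<subseteq> t_Max \<and> \<M>2 \<subseteq> t_Max \<and> \<M>1 \<noteq> \<M>2 \<longrightarrow>
        (\<Inter>M\<in>\<M>1. localization M) \<noteq> (\<Inter>M\<in>\<M>2. localization M))"

end

theory Submission
  imports Defs
begin

text \<open>
  The whole theorem rests on one translation: for \<open>u\<close> in \<open>K\<close> and an ideal \<open>M\<close>, the element \<open>u\<close>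
  lies in \<open>R\<^sub>M\<close> exactly when its ideal of denominators \<open>(R :\<^sub>R u)\<close> is not contained in \<open>M\<close>
  (\<open>mem_localization_iff_conductor\<close>). Hence \<open>u\<close> lies in every \<open>R\<^sub>M\<close> with \<open>M \<noteq> N\<close> but not in
  \<open>R\<^sub>N\<close> if and only if \<open>N\<close> is the only maximal \<open>t\<close>-ideal containing \<open>(R :\<^sub>R u)\<close>: isolating \<open>N\<close> by
  a conductor is the irredundancy of \<open>R\<^sub>N\<close> in the intersection, read off at a single element.

  The main further input is that maximal \<open>t\<close>-ideals suffice to recognise \<open>R\<close>. A conductor is the
  inverse of \<open>{1, u}\<close>, hence divisorial, hence a \<open>t\<close>-ideal, and it is proper when \<open>u \<notin> R\<close>. Since
  the \<open>t\<close>-closure only looks at finitely generated ideals, unions of chains of \<open>t\<close>-ideals are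
  \<open>t\<close>-ideals, and Zorn's lemma puts the conductor inside a maximal \<open>t\<close>-ideal \<open>M\<close>
  (\<open>conductor_le_t_Max\<close>); then \<open>u \<notin> R\<^sub>M\<close>. It follows that \<open>R\<close> is the intersection of all the
  \<open>R\<^sub>M\<close>, so \<open>R\<^sub>N\<close> is redundant precisely when the remaining localizations still intersect in \<open>R\<close>.

  The \<open>t#\<close>-property and the incomparability of intersections over disjoint sets reduce to
  irredundancy by monotonicity: if \<open>N\<close> is not in a set of maximal \<open>t\<close>-ideals, then the
  intersection over that set contains the intersection over all \<open>M \<noteq> N\<close>. The case of a single
  maximal \<open>t\<close>-ideal \<open>N\<close> needs in addition \<open>R\<^sub>N \<noteq> K\<close>, which holds because \<open>N \<noteq> 0\<close>.

  For isolation by a divisorial ideal, an isolating conductor is itself divisorial.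
  Conversely, a divisorial ideal \<open>I\<close> contained in \<open>N\<close> is not \<open>R\<close>, so \<open>I\<inverse>\<close> has an element
  \<open>u \<notin> R\<close>; the conductor of \<open>u\<close> contains \<open>I\<close>, so a maximal \<open>t\<close>-ideal containing the conductor
  contains \<open>I\<close>, and the conductor inherits the isolation of \<open>I\<close>.
\<close>

section \<open>Inverses and divisorial closure\<close>

lemma to_fract_mem_base_ring: "to_fract r \<in> base_ring"
  by (simp add: base_ring_def)

lemma zero_mem_base_ring: "0 \<in> base_ring"
  using to_fract_mem_base_ring[of 0] by simp

lemma one_mem_base_ring: "1 \<in> base_ring"
  using to_fract_mem_base_ring[of 1] by simp

lemma add_mem_base_ring:
  assumes "x \<in> base_ring" "y \<in> base_ring"
  shows "x + y \<in> base_ring"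
proof -
  obtain a b where "x = to_fract a" "y = to_fract b"
    using assms unfolding base_ring_def by blast
  then show ?thesis
    using to_fract_mem_base_ring[of "a + b"] by simp
qed

lemma mult_mem_base_ring:
  assumes "x \<in> base_ring" "y \<in> base_ring"
  shows "x * y \<in> base_ring"
proof -
  obtain a b where "x = to_fract a" "y = to_fract b"
    using assms unfolding base_ring_def by blast
  then show ?thesis
    using to_fract_mem_base_ring[of "a * b"] by simp
qed

lemma subspace_ideal_inverse: "frac.subspace (ideal_inverse I)"
proof (rule frac.subspaceI)
  show "0 \<in> ideal_inverse I"
    by (simp add: ideal_inverse_def zero_mem_base_ring)
  show "x + y \<in> ideal_inverse I" if "x \<in> ideal_inverse I" "y \<in> ideal_inverse I" for x y
    using that by (simp add: ideal_inverse_def distrib_right add_mem_base_ring)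
  show "to_fract c * x \<in> ideal_inverse I" if "x \<in> ideal_inverse I" for c x
    using that
    by (simp add: ideal_inverse_def mult.assoc mult_mem_base_ring to_fract_mem_base_ring)
qed

lemma ideal_inverse_antimono: "I \<subseteq> J \<Longrightarrow> ideal_inverse J \<subseteq> ideal_inverse I"
  by (auto simp: ideal_inverse_def)

lemma v_closure_mono: "I \<subseteq> J \<Longrightarrow> v_closure I \<subseteq> v_closure J"
  unfolding v_closure_def by (intro ideal_inverse_antimono)

lemma subset_v_closure: "I \<subseteq> v_closure I"
  by (auto simp: v_closure_def ideal_inverse_def mult.commute)

text \<open>Inversion is an antitone Galois connection with itself, so three inversions are one.\<close>

lemma v_closure_ideal_inverse: "v_closure (ideal_inverse I) = ideal_inverse I"
proof
  show "v_closure (ideal_inverse I) \<subseteq> ideal_inverse I"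
    using ideal_inverse_antimono[OF subset_v_closure[of I]] by (simp add: v_closure_def)
qed (rule subset_v_closure)

lemma t_closure_subset_v_closure: "t_closure I \<subseteq> v_closure I"
  unfolding t_closure_def using v_closure_mono by blast

lemma subset_t_closure:
  assumes "frac.subspace I" "I \<noteq> {0}"
  shows "I \<subseteq> t_closure I"
proof
  fix x assume x: "x \<in> I"
  obtain y where y: "y \<in> I" "y \<noteq> 0"
    using frac.subspace_0[OF assms(1)] assms(2) by blast
  \<comment> \<open>The second generator keeps the submodule nonzero when \<open>x = 0\<close>.\<close>
  let ?J = "frac.span {x, y}"
  have "finitely_generated ?J"
    unfolding finitely_generated_def by (intro exI[of _ "{x, y}"]) simp
  moreover have x_mem: "x \<in> ?J" and "y \<in> ?J"
    by (simp_all add: frac.span_base)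
  moreover from this y(2) have "?J \<noteq> {0}"
    by blast
  moreover have "?J \<subseteq> I"
    using assms(1) x y(1) by (intro frac.span_minimal) auto
  ultimately have "v_closure ?J \<subseteq> t_closure I"
    unfolding t_closure_def by blast
  then show "x \<in> t_closure I"
    using x_mem subset_v_closure by blast
qed

lemma divisorial_imp_t_ideal:
  assumes "divisorial I"
  shows "t_ideal I"
proof -
  have I: "nonzero_fractional_ideal I"
    using assms by (simp add: divisorial_def)
  have v: "v_closure I = I"
    using assms unfolding divisorial_def by (elim conjE) (erule sym)
  have "I \<subseteq> t_closure I"
    using I by (intro subset_t_closure) (auto simp: nonzero_fractional_ideal_def)
  moreover have "t_closure I \<subseteq> I"
    using t_closure_subset_v_closure[of I] by (simp only: v)
  ultimately show ?thesis
    using I unfolding t_ideal_def by blast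
qed

section \<open>Existence of maximal t-ideals\<close>

lemma nonzero_fractional_ideal_if_subset_base_ring:
  assumes "frac.subspace I" "I \<noteq> {0}" "I \<subseteq> base_ring"
  shows "nonzero_fractional_ideal I"
  unfolding nonzero_fractional_ideal_def
  using assms by (auto intro!: exI[of _ 1])

lemma subspace_psubset_base_ring_iff:
  assumes "frac.subspace I"
  shows "I \<subset> base_ring \<longleftrightarrow> I \<subseteq> base_ring \<and> 1 \<notin> I"
proof -
  have "base_ring \<subseteq> I" if "1 \<in> I"
    using frac.subspace_scale[OF assms that] by (auto simp: base_ring_def)
  then show ?thesis
    using one_mem_base_ring by blast
qed

lemma proper_integral_t_ideal_iff:
  "proper_integral_t_ideal I \<longleftrightarrow>
     frac.subspace I \<and> I \<noteq> {0} \<and> I \<subseteq> base_ring \<and> 1 \<notin> I \<and> t_closure I \<subseteq> I"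
proof
  assume "proper_integral_t_ideal I"
  then show "frac.subspace I \<and> I \<noteq> {0} \<and> I \<subseteq> base_ring \<and> 1 \<notin> I \<and> t_closure I \<subseteq> I"
    using subspace_psubset_base_ring_iff[of I]
    unfolding proper_integral_t_ideal_def t_ideal_def nonzero_fractional_ideal_def by blast
next
  assume "frac.subspace I \<and> I \<noteq> {0} \<and> I \<subseteq> base_ring \<and> 1 \<notin> I \<and> t_closure I \<subseteq> I"
  then show "proper_integral_t_ideal I"
    using subspace_psubset_base_ring_iff[of I] subset_t_closure[of I]
      nonzero_fractional_ideal_if_subset_base_ring[of I]
    unfolding proper_integral_t_ideal_def t_ideal_def by blast
qed

lemma subspace_Union_chain:
  assumes chain: "subset.chain \<A> \<C>" and ne: "\<C> \<noteq> {}"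
    and sub: "\<And>I. I \<in> \<C> \<Longrightarrow> frac.subspace I"
  shows "frac.subspace (\<Union>\<C>)"
proof (rule frac.subspaceI)
  show "0 \<in> \<Union>\<C>"
    using ne sub frac.subspace_0 by blast
next
  fix x y assume "x \<in> \<Union>\<C>" "y \<in> \<Union>\<C>"
  then obtain I where "I \<in> \<C>" "x \<in> I" "y \<in> I"
    using chain unfolding subset_chain_def by blast
  then show "x + y \<in> \<Union>\<C>"
    using sub frac.subspace_add by blast
next
  fix c x assume "x \<in> \<Union>\<C>"
  then show "to_fract c * x \<in> \<Union>\<C>"
    using sub frac.subspace_scale by blast
qed

text \<open>
  The \<open>t\<close>-operation has finite character: a finitely generated submodule of the union of a chain
  already lies in one member of the chain, which is \<open>t\<close>-closed. For the divisorial closure the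
  same statement fails in general, and this is why \<open>t\<close>-ideals rather than divisorial ones have enough
  maximal elements.
\<close>

lemma t_closure_Union_chain:
  assumes chain: "subset.chain \<A> \<C>" and ne: "\<C> \<noteq> {}"
    and sub: "\<And>I. I \<in> \<C> \<Longrightarrow> frac.subspace I"
    and closed: "\<And>I. I \<in> \<C> \<Longrightarrow> t_closure I \<subseteq> I"
  shows "t_closure (\<Union>\<C>) \<subseteq> \<Union>\<C>"
proof
  fix x assume "x \<in> t_closure (\<Union>\<C>)"
  then obtain S where S: "finite S" "frac.span S \<noteq> {0}" "frac.span S \<subseteq> \<Union>\<C>"
    and x: "x \<in> v_closure (frac.span S)"
    unfolding t_closure_def finitely_generated_def by blast
  have "S \<subseteq> \<Union>\<C>"
    using S(3) frac.span_superset[of S] by blast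
  then obtain I where I: "I \<in> \<C>" "S \<subseteq> I"
    using finite_subset_Union_chain[OF S(1) _ ne chain] by blast
  have "frac.span S \<subseteq> I"
    using I sub by (intro frac.span_minimal) auto
  then have "x \<in> t_closure I"
    unfolding t_closure_def finitely_generated_def using S(1,2) x by blast
  then show "x \<in> \<Union>\<C>"
    using closed I(1) by blast
qed

lemma proper_integral_t_ideal_le_t_Max:
  assumes "proper_integral_t_ideal I"
  obtains M where "M \<in> t_Max" "I \<subseteq> M"
proof -
  define \<A> where "\<A> = {P. proper_integral_t_ideal P \<and> I \<subseteq> P}"
  have "\<exists>M\<in>\<A>. \<forall>P\<in>\<A>. M \<subseteq> P \<longrightarrow> P = M"
  proof (rule subset_Zorn_nonempty)
    show "\<A> \<noteq> {}"
      using assms by (auto simp: \<A>_def)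
  next
    fix \<C> assume ne: "\<C> \<noteq> {}" and chain: "subset.chain \<A> \<C>"
    have mem: "proper_integral_t_ideal P" "I \<subseteq> P" if "P \<in> \<C>" for P
      using chain that by (auto simp: subset_chain_def \<A>_def)
    have sub: "frac.subspace P" and nz: "P \<noteq> {0}" and integral: "P \<subseteq> base_ring"
      and proper: "1 \<notin> P" and closed: "t_closure P \<subseteq> P" if "P \<in> \<C>" for P
      using mem(1)[OF that] by (simp_all add: proper_integral_t_ideal_iff)
    obtain P where P: "P \<in> \<C>"
      using ne by blast
    have "\<Union>\<C> \<noteq> {0}"
      using P nz[OF P] frac.subspace_0[OF sub[OF P]] by blast
    moreover have "\<Union>\<C> \<subseteq> base_ring" "1 \<notin> \<Union>\<C>"
      using integral proper by blast+
    ultimately have "proper_integral_t_ideal (\<Union>\<C>)"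
      using subspace_Union_chain[OF chain ne sub] t_closure_Union_chain[OF chain ne sub closed]
      by (simp add: proper_integral_t_ideal_iff)
    moreover have "I \<subseteq> \<Union>\<C>"
      using P mem(2) by blast
    ultimately show "\<Union>\<C> \<in> \<A>"
      by (simp add: \<A>_def)
  qed
  then obtain M where M: "M \<in> \<A>" and max: "\<And>P. P \<in> \<A> \<Longrightarrow> M \<subseteq> P \<Longrightarrow> P = M"
    by blast
  show thesis
  proof (rule that)
    show "I \<subseteq> M"
      using M by (simp add: \<A>_def)
    have "P = M" if "proper_integral_t_ideal P" "M \<subseteq> P" for P
      using that \<open>I \<subseteq> M\<close> by (intro max) (simp_all add: \<A>_def)
    then show "M \<in> t_Max"
      using M by (simp add: \<A>_def t_Max_def)
  qed
qed

lemma t_Max_memD: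
  assumes "M \<in> t_Max"
  shows "frac.subspace M" "M \<subseteq> base_ring" "0 \<in> M" "1 \<notin> M" "M \<noteq> {0}"
proof -
  have "proper_integral_t_ideal M"
    using assms by (simp add: t_Max_def)
  then show "frac.subspace M" "M \<subseteq> base_ring" "1 \<notin> M" "M \<noteq> {0}"
    by (simp_all add: proper_integral_t_ideal_iff)
  then show "0 \<in> M"
    by (simp add: frac.subspace_0)
qed

section \<open>Conductors\<close>

lemma conductor_eq_ideal_inverse: "conductor u = ideal_inverse {1, u}"
  by (auto simp: conductor_def ideal_inverse_def)

lemma conductor_nonzero: "conductor u \<noteq> {0}"
proof -
  obtain a b where u: "u = Fract a b" and b: "b \<noteq> 0"
    by (cases u)
  have "to_fract b * u = to_fract a"
    using b by (simp add: u to_fract_def eq_fract)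
  then have "to_fract b \<in> conductor u"
    by (simp add: conductor_def to_fract_mem_base_ring)
  then show ?thesis
    using b by auto
qed

lemma one_mem_conductor_iff: "1 \<in> conductor u \<longleftrightarrow> u \<in> base_ring"
  by (simp add: conductor_def one_mem_base_ring)

lemma divisorial_conductor: "divisorial (conductor u)"
proof -
  have "frac.subspace (conductor u)"
    by (simp add: conductor_eq_ideal_inverse subspace_ideal_inverse)
  then have "nonzero_fractional_ideal (conductor u)"
    using conductor_nonzero
    by (intro nonzero_fractional_ideal_if_subset_base_ring) (auto simp: conductor_def)
  then show ?thesis
    by (simp add: divisorial_def conductor_eq_ideal_inverse v_closure_ideal_inverse)
qed

lemma conductor_le_t_Max:
  assumes "u \<notin> base_ring"
  obtains M where "M \<in> t_Max" "conductor u \<subseteq> M"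
proof (rule proper_integral_t_ideal_le_t_Max)
  have "conductor u \<subseteq> base_ring"
    by (simp add: conductor_def)
  then have "conductor u \<subset> base_ring"
    using assms one_mem_conductor_iff[of u] one_mem_base_ring by blast
  then show "proper_integral_t_ideal (conductor u)"
    by (simp add: proper_integral_t_ideal_def divisorial_imp_t_ideal divisorial_conductor)
qed (rule that)

text \<open>
  A fraction representing \<open>u\<close> with denominator outside \<open>M\<close> is the same thing as an element of the
  conductor outside \<open>M\<close>; as \<open>0 \<in> M\<close>, such an element can be divided by.
\<close>

lemma mem_localization_iff_conductor:
  assumes "0 \<in> M"
  shows "u \<in> localization M \<longleftrightarrow> \<not> conductor u \<subseteq> M"
proof
  assume "u \<in> localization M"
  then obtain a s where u: "u = a / s" "a \<in> base_ring" "s \<in> base_ring" "s \<notin> M"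
    by (auto simp: localization_def)
  moreover from this assms have "s \<noteq> 0"
    by blast
  ultimately have "s \<in> conductor u"
    by (simp add: conductor_def)
  with \<open>s \<notin> M\<close> show "\<not> conductor u \<subseteq> M"
    by blast
next
  assume "\<not> conductor u \<subseteq> M"
  then obtain s where s: "s \<in> base_ring" "s * u \<in> base_ring" "s \<notin> M"
    by (auto simp: conductor_def)
  moreover from this assms have "s \<noteq> 0"
    by blast
  then have "u = (s * u) / s"
    by simp
  ultimately show "u \<in> localization M"
    unfolding localization_def by blast
qed

lemma mem_localization_t_Max_iff:
  "M \<in> t_Max \<Longrightarrow> u \<in> localization M \<longleftrightarrow> \<not> conductor u \<subseteq> M"
  by (intro mem_localization_iff_conductor t_Max_memD)

lemma base_ring_eq_Inter_localization:
  "(base_ring :: 'a::idom fract set) = (\<Inter>M\<in>t_Max. localization M)"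
proof (intro equalityI subsetI INT_I)
  fix u :: "'a fract" and M :: "'a fract set" assume "u \<in> base_ring" and M: "M \<in> t_Max"
  then show "u \<in> localization M"
    unfolding mem_localization_t_Max_iff[OF M]
    using one_mem_conductor_iff[of u] t_Max_memD(4)[OF M] by blast
next
  fix u :: "'a fract" assume u: "u \<in> (\<Inter>M\<in>t_Max. localization M)"
  show "u \<in> base_ring"
  proof (rule ccontr)
    assume "u \<notin> base_ring"
    then obtain M where "M \<in> t_Max" "conductor u \<subseteq> M"
      by (rule conductor_le_t_Max)
    with u show False
      using mem_localization_t_Max_iff by blast
  qed
qed

lemma localization_t_Max_neq_UNIV:
  assumes M: "M \<in> t_Max"
  shows "localization M \<noteq> UNIV"
proof -
  obtain y where y: "y \<in> M" "y \<noteq> 0"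
    using t_Max_memD(3,5)[OF M] by blast
  have sub: "frac.subspace M"
    using M by (rule t_Max_memD)
  \<comment> \<open>The denominators of \<open>1 / y\<close> are the multiples of \<open>y\<close>, and \<open>y \<in> M\<close>.\<close>
  have "r \<in> M" if "r \<in> conductor (1 / y)" for r
  proof -
    have "r / y \<in> base_ring"
      using that by (simp add: conductor_def)
    then obtain c where "r / y = to_fract c"
      unfolding base_ring_def by blast
    then have "r = to_fract c * y"
      using y(2) by (simp add: nonzero_divide_eq_eq)
    then show ?thesis
      using frac.subspace_scale[OF sub y(1)] by simp
  qed
  then have "1 / y \<notin> localization M"
    unfolding mem_localization_t_Max_iff[OF M] by blast
  then show ?thesis
    by blast
qed

section \<open>Characterizations of the t-sharp property\<close>

lemma t_sharp_domain_iff_not_redundant: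
  "t_sharp_domain TYPE('a::idom) \<longleftrightarrow>
     (\<forall>N\<in>(t_Max :: 'a fract set set). \<not> (\<Inter>M\<in>t_Max - {N}. localization M) \<subseteq> localization N)"
  (is "?sharp \<longleftrightarrow> ?irredundant")
proof
  assume sharp: ?sharp
  show ?irredundant
  proof (intro ballI notI)
    fix N :: "'a fract set"
    assume N: "N \<in> t_Max" and le: "(\<Inter>M\<in>t_Max - {N}. localization M) \<subseteq> localization N"
    have "(\<Inter>M\<in>t_Max. localization M) = (\<Inter>M\<in>t_Max - {N}. localization M)"
      using le by blast
    moreover have "t_Max - {N} \<noteq> t_Max"
      using N by blast
    ultimately show False
      using sharp unfolding t_sharp_domain_def by (metis Diff_subset order_refl)
  qed
next
  assume irredundant: ?irredundant
  have absurd: False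
    if sub: "\<M>1 \<subseteq> t_Max" "\<M>2 \<subseteq> t_Max" and N: "N \<in> \<M>1" "N \<notin> \<M>2"
      and eq: "(\<Inter>M\<in>\<M>1. localization M) = (\<Inter>M\<in>\<M>2. localization M)"
    for \<M>1 \<M>2 :: "'a fract set set" and N
  proof -
    have "(\<Inter>M\<in>t_Max - {N}. localization M) \<subseteq> (\<Inter>M\<in>\<M>2. localization M)"
      using sub(2) N(2) by blast
    also have "\<dots> \<subseteq> localization N"
      using N(1) unfolding eq[symmetric] by blast
    finally show False
      using irredundant sub(1) N(1) by blast
  qed
  show ?sharp
    unfolding t_sharp_domain_def
  proof (intro allI impI notI)
    fix \<M>1 \<M>2 :: "'a fract set set"
    assume \<M>: "\<M>1 \<subseteq> t_Max \<and> \<M>2 \<subseteq> t_Max \<and> \<M>1 \<noteq> \<M>2"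
      and eq: "(\<Inter>M\<in>\<M>1. localization M) = (\<Inter>M\<in>\<M>2. localization M)"
    then consider N where "N \<in> \<M>1" "N \<notin> \<M>2" | N where "N \<in> \<M>2" "N \<notin> \<M>1"
      by blast
    then show False
      using absurd[of \<M>1 \<M>2] absurd[of \<M>2 \<M>1] \<M> eq by cases auto
  qed
qed

lemma not_redundant_iff_base_ring_neq:
  assumes "N \<in> t_Max"
  shows "\<not> (\<Inter>M\<in>t_Max - {N}. localization M) \<subseteq> localization N \<longleftrightarrow>
    base_ring \<noteq> (\<Inter>M\<in>t_Max - {N}. localization M)"
  using assms unfolding base_ring_eq_Inter_localization by blast

lemma not_redundant_iff_incomparable:
  "(\<forall>N\<in>(t_Max :: 'a::idom fract set set).
      \<not> (\<Inter>M\<in>t_Max - {N}. localization M) \<subseteq> localization N) \<longleftrightarrow>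
   (\<forall>\<M>1 \<M>2 :: 'a fract set set.
      \<M>1 \<subseteq> t_Max \<and> \<M>2 \<subseteq> t_Max \<and> \<M>1 \<noteq> {} \<and> \<M>2 \<noteq> {} \<and> \<M>1 \<inter> \<M>2 = {} \<longrightarrow>
      \<not> (\<Inter>M\<in>\<M>1. localization M) \<subseteq> (\<Inter>M\<in>\<M>2. localization M) \<and>
      \<not> (\<Inter>M\<in>\<M>2. localization M) \<subseteq> (\<Inter>M\<in>\<M>1. localization M))"
  (is "?irredundant \<longleftrightarrow> ?incomparable")
proof
  assume irredundant: ?irredundant
  have not_le: "\<not> (\<Inter>M\<in>\<M>1. localization M) \<subseteq> (\<Inter>M\<in>\<M>2. localization M)"
    if sub: "\<M>1 \<subseteq> t_Max" "\<M>2 \<subseteq> t_Max" and ne: "\<M>2 \<noteq> {}" and disj: "\<M>1 \<inter> \<M>2 = {}"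
    for \<M>1 \<M>2 :: "'a fract set set"
  proof
    assume le: "(\<Inter>M\<in>\<M>1. localization M) \<subseteq> (\<Inter>M\<in>\<M>2. localization M)"
    obtain N where N: "N \<in> \<M>2"
      using ne by blast
    have "(\<Inter>M\<in>t_Max - {N}. localization M) \<subseteq> (\<Inter>M\<in>\<M>1. localization M)"
      using sub(1) disj N by blast
    also note le
    also have "(\<Inter>M\<in>\<M>2. localization M) \<subseteq> localization N"
      using N by blast
    finally show False
      using irredundant sub(2) N by blast
  qed
  show ?incomparable
  proof (intro allI impI)
    fix \<M>1 \<M>2 :: "'a fract set set"
    assume "\<M>1 \<subseteq> t_Max \<and> \<M>2 \<subseteq> t_Max \<and> \<M>1 \<noteq> {} \<and> \<M>2 \<noteq> {} \<and> \<M>1 \<inter> \<M>2 = {}"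
    then show "\<not> (\<Inter>M\<in>\<M>1. localization M) \<subseteq> (\<Inter>M\<in>\<M>2. localization M) \<and>
      \<not> (\<Inter>M\<in>\<M>2. localization M) \<subseteq> (\<Inter>M\<in>\<M>1. localization M)"
      using not_le[of \<M>1 \<M>2] not_le[of \<M>2 \<M>1] by (simp add: Int_commute)
  qed
next
  assume incomparable: ?incomparable
  show ?irredundant
  proof
    fix N :: "'a fract set" assume N: "N \<in> t_Max"
    show "\<not> (\<Inter>M\<in>t_Max - {N}. localization M) \<subseteq> localization N"
    proof (cases "t_Max - {N} = {}")
      case True
      \<comment> \<open>Incomparability says nothing about a single maximal \<open>t\<close>-ideal; the empty intersection
        is then \<open>K\<close>, which is not \<open>R\<^sub>N\<close>.\<close>
      then show ?thesis
        using localization_t_Max_neq_UNIV[OF N] by auto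
    next
      case False
      then show ?thesis
        using incomparable[rule_format, of "t_Max - {N}" "{N}"] N by auto
    qed
  qed
qed

lemma not_redundant_iff_isolating_conductor:
  assumes N: "N \<in> t_Max"
  shows "\<not> (\<Inter>M\<in>t_Max - {N}. localization M) \<subseteq> localization N \<longleftrightarrow>
    (\<exists>u. u \<notin> base_ring \<and> conductor u \<subseteq> N \<and> (\<forall>M\<in>t_Max. conductor u \<subseteq> M \<longrightarrow> M = N))"
  (is "\<not> ?L \<subseteq> _ \<longleftrightarrow> _")
proof -
  have "u \<in> ?L \<longleftrightarrow> (\<forall>M\<in>t_Max - {N}. \<not> conductor u \<subseteq> M)" for u
    by (simp add: mem_localization_t_Max_iff)
  then have L: "u \<in> ?L \<longleftrightarrow> (\<forall>M\<in>t_Max. conductor u \<subseteq> M \<longrightarrow> M = N)" for u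
    by blast
  have mem_N: "u \<in> localization N \<longleftrightarrow> \<not> conductor u \<subseteq> N" for u
    using N by (rule mem_localization_t_Max_iff)
  have outside: "u \<notin> base_ring" if "conductor u \<subseteq> N" for u
    using that one_mem_conductor_iff[of u] t_Max_memD(4)[OF N] by blast
  have "\<not> ?L \<subseteq> localization N \<longleftrightarrow> (\<exists>u. u \<in> ?L \<and> u \<notin> localization N)"
    by (simp only: subset_iff not_all not_imp)
  also have "\<dots> \<longleftrightarrow> (\<exists>u. (\<forall>M\<in>t_Max. conductor u \<subseteq> M \<longrightarrow> M = N) \<and> conductor u \<subseteq> N)"
    by (simp only: L mem_N not_not)
  finally show ?thesis
    using outside by metis
qed

lemma isolating_conductor_iff_isolating_divisorial:
  assumes N: "N \<in> t_Max"
  shows "(\<exists>u. u \<notin> base_ring \<and> conductor u \<subseteq> N \<and> (\<forall>M\<in>t_Max. conductor u \<subseteq> M \<longrightarrow> M = N)) \<longleftrightarrow>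
    (\<exists>I. divisorial I \<and> I \<subseteq> N \<and> (\<forall>M\<in>t_Max. I \<subseteq> M \<longrightarrow> M = N))"
proof
  assume "\<exists>u. u \<notin> base_ring \<and> conductor u \<subseteq> N \<and> (\<forall>M\<in>t_Max. conductor u \<subseteq> M \<longrightarrow> M = N)"
  then show "\<exists>I. divisorial I \<and> I \<subseteq> N \<and> (\<forall>M\<in>t_Max. I \<subseteq> M \<longrightarrow> M = N)"
    using divisorial_conductor by blast
next
  assume "\<exists>I. divisorial I \<and> I \<subseteq> N \<and> (\<forall>M\<in>t_Max. I \<subseteq> M \<longrightarrow> M = N)"
  then obtain I where I: "divisorial I" "I \<subseteq> N" and only: "\<And>M. M \<in> t_Max \<Longrightarrow> I \<subseteq> M \<Longrightarrow> M = N"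
    by blast
  have integral: "I \<subseteq> base_ring"
    using I(2) t_Max_memD(2)[OF N] by (rule subset_trans)
  have "\<not> ideal_inverse I \<subseteq> base_ring"
  proof
    assume "ideal_inverse I \<subseteq> base_ring"
    then have "1 \<in> v_closure I"
      by (auto simp: v_closure_def ideal_inverse_def)
    then show False
      using I t_Max_memD(4)[OF N] unfolding divisorial_def by blast
  qed
  then obtain u where u: "u \<in> ideal_inverse I" "u \<notin> base_ring"
    by blast
  have I_le: "I \<subseteq> conductor u"
    using u(1) integral by (auto simp: conductor_def ideal_inverse_def mult.commute)
  obtain M where "M \<in> t_Max" "conductor u \<subseteq> M"
    using u(2) by (rule conductor_le_t_Max)
  then have "conductor u \<subseteq> N"
    using only I_le by blast
  then show "\<exists>u. u \<notin> base_ring \<and> conductor u \<subseteq> N \<and> (\<forall>M\<in>t_Max. conductor u \<subseteq> M \<longrightarrow> M = N)"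
    using u(2) only I_le by blast
qed

theorem theorem1p2:
  shows
  "(t_sharp_domain TYPE('a::idom) \<longleftrightarrow>
      (\<forall>N\<in>(t_Max :: 'a fract set set).
          \<not> (\<Inter>M\<in>t_Max - {N}. localization M) \<subseteq> localization N)) \<and>
   (t_sharp_domain TYPE('a) \<longleftrightarrow>
      (\<forall>N\<in>(t_Max :: 'a fract set set).
          base_ring \<noteq> (\<Inter>M\<in>t_Max - {N}. localization M))) \<and>
   (t_sharp_domain TYPE('a) \<longleftrightarrow>
      (\<forall>\<M>1 \<M>2 :: 'a fract set set.
          \<M>1 \<subseteq> t_Max \<and> \<M>2 \<subseteq> t_Max \<and> \<M>1 \<noteq> {} \<and> \<M>2 \<noteq> {} \<and> \<M>1 \<inter> \<M>2 = {} \<longrightarrow>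
          \<not> (\<Inter>M\<in>\<M>1. localization M) \<subseteq> (\<Inter>M\<in>\<M>2. localization M) \<and>
          \<not> (\<Inter>M\<in>\<M>2. localization M) \<subseteq> (\<Inter>M\<in>\<M>1. localization M))) \<and>
   (t_sharp_domain TYPE('a) \<longleftrightarrow>
      (\<forall>M\<in>(t_Max :: 'a fract set set).
          \<exists>I. divisorial I \<and> I \<subseteq> M \<and> (\<forall>M'\<in>t_Max. I \<subseteq> M' \<longrightarrow> M' = M))) \<and>
   (t_sharp_domain TYPE('a) \<longleftrightarrow>
      (\<forall>M\<in>(t_Max :: 'a fract set set).
          \<exists>u. u \<notin> base_ring \<and> conductor u \<subseteq> M \<and>
              (\<forall>M'\<in>t_Max. conductor u \<subseteq> M' \<longrightarrow> M' = M)))"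
proof (intro conjI)
  show "t_sharp_domain TYPE('a) \<longleftrightarrow>
      (\<forall>N\<in>(t_Max :: 'a fract set set).
          \<not> (\<Inter>M\<in>t_Max - {N}. localization M) \<subseteq> localization N)"
    by (rule t_sharp_domain_iff_not_redundant)
  show "t_sharp_domain TYPE('a) \<longleftrightarrow>
      (\<forall>N\<in>(t_Max :: 'a fract set set).
          base_ring \<noteq> (\<Inter>M\<in>t_Max - {N}. localization M))"
    unfolding t_sharp_domain_iff_not_redundant
    by (intro ball_cong refl not_redundant_iff_base_ring_neq)
  show "t_sharp_domain TYPE('a) \<longleftrightarrow>
      (\<forall>\<M>1 \<M>2 :: 'a fract set set.
          \<M>1 \<subseteq> t_Max \<and> \<M>2 \<subseteq> t_Max \<and> \<M>1 \<noteq> {} \<and> \<M>2 \<noteq> {} \<and> \<M>1 \<inter> \<M>2 = {} \<longrightarrow>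
          \<not> (\<Inter>M\<in>\<M>1. localization M) \<subseteq> (\<Inter>M\<in>\<M>2. localization M) \<and>
          \<not> (\<Inter>M\<in>\<M>2. localization M) \<subseteq> (\<Inter>M\<in>\<M>1. localization M))"
    unfolding t_sharp_domain_iff_not_redundant by (rule not_redundant_iff_incomparable)
  show "t_sharp_domain TYPE('a) \<longleftrightarrow>
      (\<forall>M\<in>(t_Max :: 'a fract set set).
          \<exists>I. divisorial I \<and> I \<subseteq> M \<and> (\<forall>M'\<in>t_Max. I \<subseteq> M' \<longrightarrow> M' = M))"
    unfolding t_sharp_domain_iff_not_redundant
    by (intro ball_cong refl)
      (simp only: not_redundant_iff_isolating_conductor isolating_conductor_iff_isolating_divisorial)
  show "t_sharp_domain TYPE('a) \<longleftrightarrow>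
      (\<forall>M\<in>(t_Max :: 'a fract set set).
          \<exists>u. u \<notin> base_ring \<and> conductor u \<subseteq> M \<and>
              (\<forall>M'\<in>t_Max. conductor u \<subseteq> M' \<longrightarrow> M' = M))"
    unfolding t_sharp_domain_iff_not_redundant
    by (intro ball_cong refl not_redundant_iff_isolating_conductor)
qed

end
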